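(* Let $k\ge 3$. For every greedy adaptive priority algorithm $A$ in the vertex model for $k$-uniform hypergraph matching there exists a $k$-uniform hypergraph $H$ such that the matching computed by $A$ on $H$ has size at most $\frac1k\,\nu(H)$. That is, no such algorithm achieves an approximation ratio better than $\frac1k$.
   Context: A $k$-uniform hypergraph $H=(V,E)$ has hyperedges that are $k$-element subsets of $V$; a matching is a set of pairwise disjoint hyperedges and $\nu(H)$ is the maximum size of a matching. Vertex model: the data item of a node $u$ is $\langle u;V_1,\dots,V_d\rangle$, where $\{u\}\cup V_1,\dots,\{u\}\cup V_d$ are all hyperedges containing $u$. A greedy adaptive priority algorithm proceeds in rounds: in each round it deterministically chooses, as a function only of the data items received and decisions made so far (without otherwise looking at the input), a total order on all possible data items, and receives the first data item (w.r.t. this order) of the input whose node $u$ is uncovered and lies in some hyperedge all of whose nodes are uncovered; it must then irrevocably add to its matching some hyperedge containing $u$ all of whose nodes are uncovered. This repeats until no such node remains. *)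

theory Defs
  imports Complex_Main "HOL-Library.Disjoint_Sets" "HOL-Library.While_Combinator"
begin

definition uniform_hypergraph :: "nat \<Rightarrow> 'a set \<Rightarrow> 'a set set \<Rightarrow> bool" where
  "uniform_hypergraph k V E \<longleftrightarrow> finite V \<and> (\<forall>e\<in>E. e \<subseteq> V \<and> card e = k)"

definition matching :: "'a set set \<Rightarrow> 'a set set \<Rightarrow> bool" where
  "matching E M \<longleftrightarrow> M \<subseteq> E \<and> disjoint M"

definition matching_number :: "'a set set \<Rightarrow> nat" where
  "matching_number E = Max (card ` {M. matching E M})"

text \<open>
  The pair \<open>(u, {V\<^sub>1, \<dots>, V\<^sub>d})\<close> encodes the data item
  \<open>\<langle>u; V\<^sub>1, \<dots>, V\<^sub>d\<rangle>\<close>, the order of the \<open>V\<^sub>i\<close> carrying no information.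
\<close>

type_synonym 'a data_item = "'a \<times> 'a set set"

definition data_items :: "nat \<Rightarrow> 'a data_item set" where
  "data_items k = {(u, N). finite N \<and> (\<forall>W\<in>N. u \<notin> W \<and> card (insert u W) = k)}"

definition data_item :: "'a set set \<Rightarrow> 'a \<Rightarrow> 'a data_item" where
  "data_item E u = (u, {e - {u} | e. e \<in> E \<and> u \<in> e})"

text \<open>
  A history lists, in chronological order, the data items received together with the
  hyperedge chosen upon receipt of each of them.
\<close>

type_synonym 'a history = "('a data_item \<times> 'a set) list"

definition covered :: "'a history \<Rightarrow> 'a set" where
  "covered h = \<Union> (snd ` set h)"

text \<open>
  The hyperedges containing the node of a data item all of whose nodes are uncovered. For a
  node \<open>u\<close>, this set is nonempty iff \<open>u\<close> is uncovered and lies in some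
  hyperedge all of whose nodes are uncovered.
\<close>

definition free_edges :: "'a history \<Rightarrow> 'a data_item \<Rightarrow> 'a set set" where
  "free_edges h d = {e. \<exists>W\<in>snd d. e = insert (fst d) W \<and> e \<inter> covered h = {}}"

record 'a algorithm =
  priority :: "'a history \<Rightarrow> 'a data_item rel"
  decision :: "'a history \<Rightarrow> 'a data_item \<Rightarrow> 'a set"

text \<open>
  The requirements are imposed on all histories, also on those that no input produces. This
  excludes no behaviour on actual inputs, since an algorithm can be completed arbitrarily on
  the other histories.
\<close>

definition greedy_adaptive_priority_algorithm :: "nat \<Rightarrow> 'a algorithm \<Rightarrow> bool" where
  "greedy_adaptive_priority_algorithm k A \<longleftrightarrow>
     (\<forall>h. linear_order_on (data_items k) (priority A h)) \<and>
     (\<forall>h. \<forall>d\<in>data_items k. free_edges h d \<noteq> {} \<longrightarrow> decision A h d \<in> free_edges h d)"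

definition eligible :: "'a set \<Rightarrow> 'a set set \<Rightarrow> 'a history \<Rightarrow> 'a data_item set" where
  "eligible V E h = {d \<in> data_item E ` V. free_edges h d \<noteq> {}}"

text \<open>The least element of \<open>D\<close>, where \<open>(d, d') \<in> r\<close> means that \<open>d\<close> comes no later than \<open>d'\<close>.\<close>

definition first :: "'b rel \<Rightarrow> 'b set \<Rightarrow> 'b" where
  "first r D = (THE d. d \<in> D \<and> (\<forall>d'\<in>D. (d, d') \<in> r))"

definition next_round :: "'a algorithm \<Rightarrow> 'a set \<Rightarrow> 'a set set \<Rightarrow> 'a history \<Rightarrow> 'a history" where
  "next_round A V E h =
     (let d = first (priority A h) (eligible V E h) in h @ [(d, decision A h d)])"

text \<open>
  On a finite hypergraph the loop terminates, since every round covers the node it receives.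
\<close>

definition computed_matching :: "'a algorithm \<Rightarrow> 'a set \<Rightarrow> 'a set set \<Rightarrow> 'a set set" where
  "computed_matching A V E =
     snd ` set (while (\<lambda>h. eligible V E h \<noteq> {}) (next_round A V E) [])"

definition achieves_ratio :: "nat \<Rightarrow> 'a algorithm \<Rightarrow> real \<Rightarrow> bool" where
  "achieves_ratio k A \<rho> \<longleftrightarrow>
     (\<forall>V E. uniform_hypergraph k V E \<longrightarrow>
        real (card (computed_matching A V E)) \<ge> \<rho> * real (matching_number E))"

end

theory Submission
  imports Defs "HOL-Combinatorics.Permutations"
begin

text \<open>
  A single round suffices. Let \<open>e\<close> be an edge of a linear hypergraph that meets every other
  edge, and suppose that there are \<open>k\<close> disjoint edges; an algorithm whose first choice is
  \<open>e\<close> is stuck with a matching of size 1. Before the first round the adversary may still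
  permute the labels: the data item that the algorithm prefers among those of all relabelled
  copies shows a node and its edges, which are otherwise disjoint, so it discloses no more than a
  degree. If every degree of the hypergraph occurs at some node of \<open>e\<close>, then some copy contains
  this data item and has the edge chosen by the algorithm in the role of \<open>e\<close>.

  Such a hypergraph is the dual of a \<open>(k - 1)\<close>-regular graph with a proper \<open>k\<close>-colouring: every
  vertex of the graph becomes a hyperedge, consisting of the graph edges at it (nodes of degree 2)
  and of one further node for its colour, and \<open>e\<close> consists of the colours. It has the desired
  properties if one colour is used only once, so that \<open>e\<close> has a node of degree 2, and if some
  independent set contains all colours. The disjoint union of \<open>K\<^sub>k\<close> and of \<open>k - 1\<close> copies of
  \<open>K\<^bsub>k-1,k-1\<^esub>\<close> can be coloured in this way. Each of these copies needs two other colours, which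
  is where \<open>k \<ge> 3\<close> enters.
\<close>

section \<open>Traps and their images under injections\<close>

definition star :: "'a set set \<Rightarrow> 'a \<Rightarrow> 'a set set" where
  "star E v = {g \<in> E. v \<in> g}"

definition linear_hypergraph :: "'a set set \<Rightarrow> bool" where
  "linear_hypergraph E \<longleftrightarrow>
     (\<forall>g\<in>E. \<forall>h\<in>E. \<forall>x y. x \<in> g \<inter> h \<longrightarrow> y \<in> g \<inter> h \<longrightarrow> x \<noteq> y \<longrightarrow> g = h)"

text \<open>The bound on the degrees makes every node eligible in the first round. Together with
  linearity it also makes \<open>v\<close> the only node common to all edges of
  \<open>star E v\<close>.\<close>

definition trap :: "nat \<Rightarrow> 'a set \<Rightarrow> 'a set set \<Rightarrow> 'a set \<Rightarrow> bool" where
  "trap k V E e \<longleftrightarrow>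
     uniform_hypergraph k V E \<and> linear_hypergraph E \<and> e \<in> E \<and> (\<forall>g\<in>E. g \<inter> e \<noteq> {}) \<and>
     (\<exists>M. matching E M \<and> card M = k) \<and>
     (\<forall>v\<in>V. card (star E v) \<ge> 2 \<and> (\<exists>u\<in>e. card (star E u) = card (star E v)))"

lemma star_image:
  assumes "inj_on f V" "\<forall>g\<in>E. g \<subseteq> V" "v \<in> V"
  shows "star ((`) f ` E) (f v) = (`) f ` star E v"
  using assms unfolding star_def by (auto dest: inj_onD)

lemma card_star_image:
  assumes "inj_on f V" "\<forall>g\<in>E. g \<subseteq> V" "v \<in> V"
  shows "card (star ((`) f ` E) (f v)) = card (star E v)"
proof -
  have "inj_on ((`) f) (star E v)"
    using assms by (intro inj_onI) (auto simp: star_def inj_on_image_eq_iff)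
  then show ?thesis
    by (simp add: star_image[OF assms] card_image)
qed

lemma linear_hypergraph_image:
  assumes "inj_on f V" "\<forall>g\<in>E. g \<subseteq> V" "linear_hypergraph E"
  shows "linear_hypergraph ((`) f ` E)"
  unfolding linear_hypergraph_def
proof (intro ballI allI impI)
  fix g' h' x y
  assume "g' \<in> (`) f ` E" "h' \<in> (`) f ` E" and x: "x \<in> g' \<inter> h'" and y: "y \<in> g' \<inter> h'" and "x \<noteq> y"
  then obtain g h where gh: "g \<in> E" "h \<in> E" "g' = f ` g" "h' = f ` h"
    by auto
  have "g' \<inter> h' = f ` (g \<inter> h)"
    using gh assms by (metis inj_on_image_Int)
  with x y \<open>x \<noteq> y\<close> obtain a b where "a \<in> g \<inter> h" "b \<in> g \<inter> h" "a \<noteq> b"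
    by auto
  with assms(3) gh show "g' = h'"
    unfolding linear_hypergraph_def by blast
qed

lemma matching_image:
  assumes "inj_on f V" "\<forall>g\<in>E. g \<subseteq> V" "matching E M"
  shows "matching ((`) f ` E) ((`) f ` M)" "card ((`) f ` M) = card M"
proof -
  have M: "M \<subseteq> E" "disjoint M"
    using assms(3) by (auto simp: matching_def)
  have "disjoint ((`) f ` M)"
  proof (rule disjointI)
    fix a b
    assume "a \<in> (`) f ` M" "b \<in> (`) f ` M" "a \<noteq> b"
    then obtain c d where cd: "c \<in> M" "d \<in> M" "a = f ` c" "b = f ` d" "c \<noteq> d"
      by auto
    then have "c \<inter> d = {}"
      using M(2) by (auto simp: disjoint_def)
    moreover have "a \<inter> b = f ` (c \<inter> d)"
      using cd assms M(1) by (metis inj_on_image_Int subsetD)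
    ultimately show "a \<inter> b = {}"
      by simp
  qed
  then show "matching ((`) f ` E) ((`) f ` M)"
    using M(1) by (auto simp: matching_def)
  have "inj_on ((`) f) M"
    using assms(1,2) M(1) by (intro inj_onI) (metis inj_on_image_eq_iff subsetD)
  then show "card ((`) f ` M) = card M"
    by (rule card_image)
qed

text \<open>Used for the relabellings by permutations of \<open>V\<close> and for moving the
  construction into the node type of the algorithm.\<close>

lemma trap_image:
  assumes "inj_on f V" "trap k V E e"
  shows "trap k (f ` V) ((`) f ` E) (f ` e)"
proof -
  have unif: "finite V" and sub: "\<forall>g\<in>E. g \<subseteq> V" and card: "\<forall>g\<in>E. card g = k" and e: "e \<in> E"
    using assms(2) by (auto simp: trap_def uniform_hypergraph_def)
  have "card (f ` g) = k" if "g \<in> E" for g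
    using that sub card assms(1) by (metis card_image inj_on_subset)
  then have "uniform_hypergraph k (f ` V) ((`) f ` E)"
    using unif sub by (auto simp: uniform_hypergraph_def)
  moreover have "linear_hypergraph ((`) f ` E)"
    using linear_hypergraph_image[OF assms(1) sub] assms(2) by (simp add: trap_def)
  moreover have "\<forall>g\<in>(`) f ` E. g \<inter> f ` e \<noteq> {}"
    using assms(2) by (fastforce simp: trap_def)
  moreover have "\<exists>M. matching ((`) f ` E) M \<and> card M = k"
    using matching_image[OF assms(1) sub] assms(2) unfolding trap_def by metis
  moreover have "card (star ((`) f ` E) v) \<ge> 2 \<and>
      (\<exists>u\<in>f ` e. card (star ((`) f ` E) u) = card (star ((`) f ` E) v))" if "v \<in> f ` V" for v
  proof -
    have "e \<subseteq> V"
      using e sub by auto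
    then show ?thesis
      using that assms(2) card_star_image[OF assms(1) sub] unfolding trap_def
      by (smt (verit, ccfv_SIG) imageE image_eqI subsetD)
  qed
  ultimately show ?thesis
    using e by (auto simp: trap_def)
qed

section \<open>Symmetry between stars of equal degree\<close>

lemma card_neq_one_ex_distinct:
  assumes "finite T" "T \<noteq> {}" "card T \<noteq> 1"
  shows "\<exists>g\<in>T. \<exists>h\<in>T. g \<noteq> h"
  using assms by (metis is_singletonI' is_singleton_altdef all_not_in_conv)

text \<open>By linearity, distinct edges of the star share only \<open>v\<close>, so removing
  \<open>v\<close> leaves disjoint sets of size \<open>k - 1\<close>. Hence the trace of a node on
  the star is full at \<open>v\<close>, a single edge at the other nodes of the star and empty
  elsewhere. The count depends on \<open>card T\<close> and the degree, not on \<open>v\<close> or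
  on which edges form \<open>T\<close>.\<close>

lemma card_star_trace:
  assumes "finite V" and unif: "\<forall>g\<in>E. g \<subseteq> V \<and> card g = k" and "linear_hypergraph E"
    and "v \<in> V" "card (star E v) \<ge> 2" "T \<subseteq> star E v"
  shows "card {x \<in> V. {g \<in> star E v. x \<in> g} = T} =
    (if card T = card (star E v) then 1 else if card T = 1 then k - 1
     else if card T = 0 then card V - 1 - card (star E v) * (k - 1) else 0)"
proof -
  let ?S = "star E v"
  let ?t = "\<lambda>x. {g \<in> ?S. x \<in> g}"
  have finS: "finite ?S"
    using assms(5) by (metis card.infinite not_numeral_le_zero)
  have finT: "finite T"
    using finS assms(6) finite_subset by blast
  have uniq: "x = v" if "g \<in> ?S" "h \<in> ?S" "g \<noteq> h" "x \<in> g" "x \<in> h" for g h x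
    using that assms(3) unfolding linear_hypergraph_def star_def by blast
  have tv: "?t v = ?S"
    by (auto simp: star_def)
  have fin_g: "finite g" "g \<subseteq> V" "card g = k" "v \<in> g" if "g \<in> ?S" for g
    using that unif \<open>finite V\<close> by (auto simp: star_def intro: finite_subset)
  \<comment> \<open>\<open>card\<close> is 0 on infinite sets, so the first premise yields
    finiteness as well as nonemptiness; a trace that contains two edges belongs to
    \<open>v\<close>.\<close>
  have centre: "x = v" if "card (?t x) \<noteq> 0" "card (?t x) \<noteq> 1" for x
  proof -
    have "finite (?t x)" "?t x \<noteq> {}"
      using that(1) by (metis card.infinite) (metis that(1) card.empty)
    from card_neq_one_ex_distinct[OF this that(2)] show ?thesis
      using uniq by blast
  qed
  consider (full) "card T = card ?S" | (single) "card T \<noteq> card ?S" "card T = 1"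
    | (none) "card T \<noteq> card ?S" "card T = 0"
    | (other) "card T \<noteq> card ?S" "card T \<noteq> 1" "card T \<noteq> 0"
    by blast
  then show ?thesis
  proof cases
    case full
    then have "T = ?S"
      using finS assms(6) card_subset_eq by blast
    have "x = v" if "?t x = T" for x
      by (rule centre, unfold that) (use full assms(5) in auto)
    then have "?t x = T \<longleftrightarrow> x = v" for x
      using tv \<open>T = ?S\<close> by blast
    then have "{x \<in> V. ?t x = T} = {v}"
      using assms(4) by auto
    with full show ?thesis
      by simp
  next
    case single
    then obtain h where T: "T = {h}"
      using card_1_singletonE by blast
    then have h: "h \<in> ?S"
      using assms(6) by simp
    have "{x \<in> V. ?t x = T} = h - {v}"
    proof (intro equalityI subsetI)
      fix x
      assume "x \<in> {x \<in> V. ?t x = T}"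
      then have x: "?t x = T"
        by simp
      then have "x \<in> h"
        unfolding T by blast
      moreover have "x \<noteq> v"
        using x single(1) tv by metis
      ultimately show "x \<in> h - {v}"
        by blast
    next
      fix x
      assume "x \<in> h - {v}"
      then show "x \<in> {x \<in> V. ?t x = T}"
        using T h fin_g(2)[OF h] uniq by blast
    qed
    then show ?thesis
      using single fin_g[OF h] by simp
  next
    case none
    have T: "T = {}"
      using none finT by simp
    let ?U = "\<Union>g\<in>?S. g - {v}"
    have "\<forall>g\<in>?S. \<forall>h\<in>?S. g \<noteq> h \<longrightarrow> (g - {v}) \<inter> (h - {v}) = {}"
      using uniq by blast
    then have "card ?U = (\<Sum>g\<in>?S. card (g - {v}))"
      using finS fin_g(1) by (intro card_UN_disjoint) auto
    also have "\<dots> = card ?S * (k - 1)"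
      using fin_g by simp
    finally have "card ?U = card ?S * (k - 1)" .
    moreover have "finite ?U" "v \<notin> ?U"
      using finS fin_g(1) by auto
    ultimately have "card (insert v ?U) = 1 + card ?S * (k - 1)"
      by (metis card_insert_disjoint plus_1_eq_Suc)
    moreover have "{x \<in> V. ?t x = T} = V - insert v ?U"
    proof -
      obtain g where "g \<in> ?S"
        using none by fastforce
      then have "?t x = {} \<longleftrightarrow> x \<notin> insert v ?U" for x
        using fin_g(4) by auto
      then show ?thesis
        unfolding T by blast
    qed
    \<comment> \<open>This inclusion makes the truncated subtraction exact.\<close>
    moreover have sub: "insert v ?U \<subseteq> V"
      using fin_g assms(4) by auto
    ultimately have "card {x \<in> V. ?t x = T} = card V - (1 + card ?S * (k - 1))"
      using card_Diff_subset[OF finite_subset[OF sub \<open>finite V\<close>] sub] by (simp only:)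
    then show ?thesis
      using none by simp
  next
    case other
    have "?t x \<noteq> T" for x
    proof
      assume x: "?t x = T"
      then have "x = v"
        using centre[of x] other by metis
      with x show False
        using tv other(1) by simp
    qed
    then have "{x \<in> V. ?t x = T} = {}"
      by simp
    with other show ?thesis
      by (metis (no_types, lifting) card.empty)
  qed
qed

text \<open>Any bijection between the two stars preserves the sizes of the trace classes, hence is
  induced by a permutation of \<open>V\<close>. So each edge at \<open>w\<close> can be moved to any
  edge at \<open>v\<close> while star goes to star.\<close>

lemma star_transport:
  assumes "finite V" and unif: "\<forall>g\<in>E. g \<subseteq> V \<and> card g = k" and "linear_hypergraph E"
    and w: "w \<in> V" and v: "v \<in> V" and deg: "card (star E w) = card (star E v)" "card (star E v) \<ge> 2"
    and g: "g \<in> star E w" and h: "h \<in> star E v"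
  obtains \<tau> where "\<tau> permutes V" "\<tau> w = v" "(`) \<tau> ` star E w = star E v" "\<tau> ` g = h"
proof -
  have fin: "finite (star E w)" "finite (star E v)"
    using deg by (metis card.infinite not_numeral_le_zero)+
  obtain \<psi> where \<psi>: "bij_betw \<psi> (star E w) (star E v)"
    using finite_same_card_bij[OF fin deg(1)] by blast
  \<comment> \<open>A transposition in the target corrects an arbitrary bijection so that
    \<open>g\<close> goes to \<open>h\<close>.\<close>
  define \<phi> where "\<phi> = transpose (\<psi> g) h \<circ> \<psi>"
  have "bij_betw (transpose (\<psi> g) h) (star E v) (star E v)"
    using \<psi> g h by (intro permutes_imp_bij permutes_swap_id) (auto simp: bij_betw_apply)
  then have \<phi>: "bij_betw \<phi> (star E w) (star E v)"
    unfolding \<phi>_def using \<psi> bij_betw_trans by blast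
  have \<phi>g: "\<phi> g = h"
    by (simp add: \<phi>_def)
  let ?c = "\<lambda>x. \<phi> ` {g \<in> star E w. x \<in> g}" and ?c' = "\<lambda>x. {g \<in> star E v. x \<in> g}"
  have "card {x \<in> V. ?c x = T} = card {x \<in> V. ?c' x = T}" for T
  proof (cases "T \<subseteq> star E v")
    case False
    then have "{x \<in> V. ?c x = T} = {}" "{x \<in> V. ?c' x = T} = {}"
      using \<phi> by (auto simp: bij_betw_def)
    then show ?thesis
      by (simp only:)
  next
    case True
    then obtain T0 where T0: "T0 \<subseteq> star E w" "T = \<phi> ` T0"
      using \<phi> by (metis bij_betw_def subset_imageE)
    have "inj_on \<phi> (star E w)"
      using \<phi> by (simp add: bij_betw_def)
    then have "?c x = T \<longleftrightarrow> {g \<in> star E w. x \<in> g} = T0" for x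
      unfolding T0(2) using T0(1) by (intro inj_on_image_eq_iff) auto
    moreover have "card T = card T0"
      using T0 \<open>inj_on \<phi> (star E w)\<close> by (metis card_image inj_on_subset)
    ultimately show ?thesis
      using card_star_trace[OF assms(1-3) w _ T0(1)] card_star_trace[OF assms(1-3) v deg(2) True] deg
      by simp
  qed
  \<comment> \<open>Fibres of equal size mean equal multisets of labels, and these yield a
    permutation of \<open>V\<close> that matches the labels.\<close>
  then have "image_mset ?c (mset_set V) = image_mset ?c' (mset_set V)"
    using assms(1) by (intro multiset_eqI) (simp add: count_image_mset_eq_card_vimage)
  then obtain \<tau> where \<tau>: "\<tau> permutes V" and c: "\<forall>x\<in>V. ?c x = ?c' (\<tau> x)"
    by (rule image_mset_eq_implies_permutes[OF assms(1)])
  have im: "\<tau> ` g = \<phi> g" if g: "g \<in> star E w" for g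
  proof -
    have sub: "g \<subseteq> V" "\<phi> g \<subseteq> V" and \<phi>v: "\<phi> g \<in> star E v"
      using g unif bij_betw_apply[OF \<phi> g] by (auto simp: star_def)
    have iff: "\<tau> x \<in> \<phi> g \<longleftrightarrow> x \<in> g" if "x \<in> V" for x
    proof -
      have "\<tau> x \<in> \<phi> g \<longleftrightarrow> \<phi> g \<in> ?c x"
        using c that \<phi>v by auto
      also have "\<dots> \<longleftrightarrow> g \<in> {g \<in> star E w. x \<in> g}"
        using \<phi> g unfolding bij_betw_def by (intro inj_on_image_mem_iff) auto
      finally show ?thesis
        using g by simp
    qed
    show ?thesis
    proof (intro equalityI subsetI)
      fix y
      assume "y \<in> \<phi> g"
      moreover from this obtain x where "x \<in> V" "y = \<tau> x"
        using sub permutes_image[OF \<tau>] by blast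
      ultimately show "y \<in> \<tau> ` g"
        using iff by auto
    qed (use iff sub in auto)
  qed
  \<comment> \<open>\<open>w\<close> carries the full trace, so its image lies in all edges of
    \<open>star E v\<close>, thus in two distinct ones, whose only common node is
    \<open>v\<close>.\<close>
  have "?c' (\<tau> w) = ?c w"
    using c w by blast
  also have "\<dots> = star E v"
    using \<phi> by (auto simp: star_def bij_betw_def)
  finally have all: "?c' (\<tau> w) = star E v" .
  have "\<tau> w = v"
  proof -
    have "star E v \<noteq> {}" "card (star E v) \<noteq> 1"
      using deg by auto
    from card_neq_one_ex_distinct[OF fin(2) this]
    obtain a b where "a \<in> star E v" "b \<in> star E v" "a \<noteq> b"
      by auto
    with all assms(3) show ?thesis
      unfolding linear_hypergraph_def star_def by blast
  qed
  moreover have "(`) \<tau> ` star E w = star E v"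
    using im \<phi> by (simp add: bij_betw_def)
  moreover have "\<tau> ` g = h"
    using im g \<phi>g by simp
  ultimately show thesis
    using that \<tau> by blast
qed

section \<open>Data items and the first round\<close>

lemma data_item_star: "data_item E u = (u, (\<lambda>g. g - {u}) ` star E u)"
  by (auto simp: data_item_def star_def)

lemma free_edges_data_item:
  "free_edges h (data_item E u) = {g \<in> star E u. g \<inter> covered h = {}}"
  by (auto simp: free_edges_def data_item_star star_def insert_absorb)

lemma data_item_in_data_items:
  assumes "uniform_hypergraph k V E"
  shows "data_item E u \<in> data_items k"
proof -
  have "E \<subseteq> Pow V" "finite V"
    using assms by (auto simp: uniform_hypergraph_def)
  then have "finite (star E u)"
    unfolding star_def by (metis (no_types, lifting) finite_Pow_iff finite_subset mem_Collect_eq subsetI)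
  then show ?thesis
    using assms by (auto simp: data_items_def data_item_star star_def uniform_hypergraph_def insert_absorb)
qed

text \<open>The orders of an algorithm need not be well-founded; least elements come from the
  finiteness of the set at hand.\<close>

lemma linear_order_on_finite_least:
  assumes "linear_order_on D r" "finite X" "X \<noteq> {}" "X \<subseteq> D"
  shows "\<exists>d\<in>X. \<forall>d'\<in>X. (d, d') \<in> r"
  using assms(2-4)
proof (induction rule: finite_ne_induct)
  case (singleton x)
  then show ?case
    using assms(1) by (auto simp: linear_order_on_def partial_order_on_def preorder_on_def refl_on_def)
next
  case (insert x X)
  then obtain d where d: "d \<in> X" "\<forall>d'\<in>X. (d, d') \<in> r"
    by auto
  have r: "refl_on D r" "trans r" "total_on D r"
    using assms(1) by (auto simp: linear_order_on_def partial_order_on_def preorder_on_def)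
  have xx: "(x, x) \<in> r"
    using r(1) insert.prems by (auto simp: refl_on_def)
  have "(x, d) \<in> r \<or> (d, x) \<in> r"
    using r(3) insert d(1) unfolding total_on_def by auto
  then show ?case
  proof
    assume "(x, d) \<in> r"
    then show ?thesis
      using d xx r(2) by (intro bexI[of _ x]) (auto dest: transD)
  next
    assume "(d, x) \<in> r"
    then show ?thesis
      using d by auto
  qed
qed

lemma first_eqI:
  assumes "linear_order_on D r" "d \<in> X" "\<forall>d'\<in>X. (d, d') \<in> r"
  shows "first r X = d"
  unfolding first_def using assms
  by (intro the_equality) (auto simp: linear_order_on_def partial_order_on_def antisym_def)

text \<open>All nodes are eligible initially, so the algorithm receives \<open>d\<close>. Once
  \<open>e\<close> is chosen, every edge contains a covered node and the loop stops, so
  \<open>while\<close> is unfolded just twice.\<close>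

lemma computed_matching_trap:
  assumes trap: "trap k V E e" and lin: "linear_order_on (data_items k) (priority A [])"
    and d: "d \<in> data_item E ` V" "\<forall>d'\<in>data_item E ` V. (d, d') \<in> priority A []"
    and dec: "decision A [] d = e"
  shows "computed_matching A V E = {e}"
proof -
  have free: "free_edges [] (data_item E v) \<noteq> {}" if "v \<in> V" for v
  proof -
    have "star E v \<noteq> {}"
      using trap that by (fastforce simp: trap_def)
    then show ?thesis
      by (simp add: free_edges_data_item covered_def)
  qed
  then have el: "eligible V E [] = data_item E ` V"
    by (auto simp: eligible_def)
  have nr: "next_round A V E [] = [(d, e)]"
    using first_eqI[OF lin d] dec by (simp add: next_round_def el)
  have "free_edges [(d, e)] (data_item E v) = {}" for v
    using trap by (auto simp: free_edges_data_item covered_def star_def trap_def)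
  then have el': "eligible V E [(d, e)] = {}"
    by (auto simp: eligible_def)
  have "while (\<lambda>h. eligible V E h \<noteq> {}) (next_round A V E) [] = [(d, e)]"
    using d(1) by (subst while_unfold, simp only: el nr, subst while_unfold) (auto simp: el')
  then show ?thesis
    by (simp add: computed_matching_def)
qed

lemma matching_number_ge:
  assumes "uniform_hypergraph k V E" "matching E M"
  shows "card M \<le> matching_number E"
proof -
  have "E \<subseteq> Pow V" "finite V"
    using assms(1) by (auto simp: uniform_hypergraph_def)
  then have "finite E"
    by (meson finite_Pow_iff finite_subset)
  then have "finite {M. matching E M}"
    by (simp add: matching_def)
  with assms(2) show ?thesis
    unfolding matching_number_def by (intro Max_ge) auto
qed

text \<open>The first order, and the decision on a given first item, do not depend on the input. So
  the adversary can fix the least item \<open>d\<close> over all relabelled copies, see which edge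
  is chosen, and then pick a copy that still contains \<open>d\<close> and has \<open>e\<close> in
  that place.\<close>

lemma trap_relabelling:
  assumes "trap k V E e" and "V \<noteq> {}" and A: "greedy_adaptive_priority_algorithm k A"
  obtains E' e' where "trap k V E' e'" "computed_matching A V E' = {e'}"
proof -
  have unif: "uniform_hypergraph k V E" and linE: "linear_hypergraph E" and eE: "e \<in> E"
    and deg: "\<forall>v\<in>V. card (star E v) \<ge> 2 \<and> (\<exists>u\<in>e. card (star E u) = card (star E v))"
    using assms(1) by (auto simp: trap_def)
  have finV: "finite V" and EV: "\<forall>g\<in>E. g \<subseteq> V" and sub: "\<forall>g\<in>E. g \<subseteq> V \<and> card g = k"
    using unif by (auto simp: uniform_hypergraph_def)
  have lin: "linear_order_on (data_items k) (priority A [])"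
    using A by (simp add: greedy_adaptive_priority_algorithm_def)
  have relabel: "trap k V ((`) p ` E) (p ` e)" if "p permutes V" for p
    using trap_image[OF permutes_inj_on[OF that] assms(1)] permutes_image[OF that] by simp
  \<comment> \<open>An item that is least in \<open>D\<close> is least in every copy that contains
    it.\<close>
  define D where "D = (\<Union>p\<in>{p. p permutes V}. data_item ((`) p ` E) ` V)"
  have "finite D"
    unfolding D_def using finite_permutations[OF finV] finV by auto
  moreover have "D \<noteq> {}"
    using assms(2) by (auto simp: D_def intro: exI[of _ id] permutes_id)
  moreover have "D \<subseteq> data_items k"
    unfolding D_def using relabel data_item_in_data_items by (fastforce simp: trap_def)
  ultimately obtain d where d: "d \<in> D" "\<forall>d'\<in>D. (d, d') \<in> priority A []"
    using linear_order_on_finite_least[OF lin] by meson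
  from d(1) obtain p u where p: "p permutes V" and u: "u \<in> V" "d = data_item ((`) p ` E) u"
    by (auto simp: D_def)
  obtain v where v: "v \<in> V" "u = p v"
    using u permutes_image[OF p] by blast
  have free: "free_edges [] d = (`) p ` star E v"
    unfolding u(2) v(2) star_image[OF permutes_inj_on[OF p] EV v(1), symmetric]
    by (auto simp: free_edges_data_item covered_def)
  have "free_edges [] d \<noteq> {}"
    using deg v(1) unfolding free by fastforce
  moreover have "d \<in> data_items k"
    using d(1) \<open>D \<subseteq> data_items k\<close> by blast
  ultimately have "decision A [] d \<in> free_edges [] d"
    using A unfolding greedy_adaptive_priority_algorithm_def by blast
  then obtain h where h: "h \<in> star E v" "decision A [] d = p ` h"
    unfolding free by auto
  \<comment> \<open>Every degree occurs in \<open>e\<close>, so some node of \<open>e\<close> can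
    take the place of \<open>v\<close>.\<close>
  obtain w where w: "w \<in> e" "card (star E w) = card (star E v)"
    using deg v(1) by blast
  have wV: "w \<in> V" and ew: "e \<in> star E w"
    using w(1) eE EV by (auto simp: star_def)
  obtain \<tau> where \<tau>: "\<tau> permutes V" "\<tau> w = v" "(`) \<tau> ` star E w = star E v" "\<tau> ` e = h"
    using star_transport[OF finV sub linE wV v(1) w(2) _ ew h(1)] deg v(1) by blast
  \<comment> \<open>\<open>\<tau>\<close> brings \<open>e\<close> to \<open>h\<close> in the
    original labels, and \<open>p\<close> then brings \<open>h\<close> to the chosen edge. The star
    of \<open>u\<close> is the same in both copies, hence so is its data item.\<close>
  define q where "q = p \<circ> \<tau>"
  have q: "q permutes V"
    unfolding q_def using \<tau>(1) p by (rule permutes_compose)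
  have "star ((`) q ` E) u = (`) q ` star E w"
    using star_image[OF permutes_inj_on[OF q] EV wV] \<tau>(2) v(2) by (simp add: q_def)
  also have "\<dots> = (`) p ` ((`) \<tau> ` star E w)"
    by (simp add: q_def image_image image_comp)
  also have "\<dots> = star ((`) p ` E) u"
    using star_image[OF permutes_inj_on[OF p] EV v(1)] \<tau>(3) v(2) by simp
  finally have du: "d = data_item ((`) q ` E) u"
    by (simp add: u(2) data_item_star)
  have "computed_matching A V ((`) q ` E) = {q ` e}"
  proof (rule computed_matching_trap[OF relabel[OF q] lin])
    show "d \<in> data_item ((`) q ` E) ` V"
      using du u(1) by blast
    show "\<forall>d'\<in>data_item ((`) q ` E) ` V. (d, d') \<in> priority A []"
      using d(2) q by (auto simp: D_def)
    show "decision A [] d = q ` e"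
      using h(2) by (simp add: q_def image_comp flip: \<tau>(4))
  qed
  with relabel[OF q] show thesis
    using that by blast
qed

section \<open>The dual of a coloured regular graph\<close>

text \<open>\<open>Inl\<close> nodes stand for colours and \<open>Inr\<close> nodes for graph edges
  as unordered pairs, so that both ends of a graph edge use the same node.\<close>

definition dual_edge :: "('b \<Rightarrow> 'b set) \<Rightarrow> ('b \<Rightarrow> nat) \<Rightarrow> 'b \<Rightarrow> (nat + 'b set) set" where
  "dual_edge nb col \<beta> = insert (Inl (col \<beta>)) ((\<lambda>\<gamma>. Inr {\<beta>, \<gamma>}) ` nb \<beta>)"

text \<open>Hyperedges of two graph vertices share their graph edge if these are adjacent and their
  colour if these are coloured alike. Properness excludes both at once, which gives
  linearity.\<close>

lemma trap_dual:
  fixes nb :: "'b \<Rightarrow> 'b set"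
  assumes "finite B" and "k \<ge> 2"
    and nb: "\<And>\<beta>. \<beta> \<in> B \<Longrightarrow> nb \<beta> \<subseteq> B" "\<And>\<beta>. \<beta> \<in> B \<Longrightarrow> card (nb \<beta>) = k - 1"
    and sym: "\<And>\<beta> \<gamma>. \<beta> \<in> B \<Longrightarrow> \<gamma> \<in> nb \<beta> \<Longrightarrow> \<beta> \<in> nb \<gamma>"
    and col: "\<And>\<beta>. \<beta> \<in> B \<Longrightarrow> col \<beta> < k"
    and proper: "\<And>\<beta> \<gamma>. \<beta> \<in> B \<Longrightarrow> \<gamma> \<in> nb \<beta> \<Longrightarrow> col \<beta> \<noteq> col \<gamma>"
    and single: "\<And>\<beta>. \<beta> \<in> B \<Longrightarrow> col \<beta> = 0 \<Longrightarrow> \<beta> = r 0"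
    and rainbow: "\<And>i. i < k \<Longrightarrow> r i \<in> B" "\<And>i. i < k \<Longrightarrow> col (r i) = i"
      "\<And>i j. i < k \<Longrightarrow> j < k \<Longrightarrow> r i \<notin> nb (r j)"
  shows "\<exists>V E e. trap k (V :: (nat + 'b set) set) E e \<and> V \<noteq> {}"
proof -
  let ?d = "dual_edge nb col"
  define e :: "(nat + 'b set) set" where "e = Inl ` {..<k}"
  define E where "E = insert e (?d ` B)"
  define V where "V = \<Union> E"
  have finnb: "finite (nb \<beta>)" if "\<beta> \<in> B" for \<beta>
    using nb(1)[OF that] assms(1) finite_subset by blast
  have mem_Inl: "Inl i \<in> ?d \<beta> \<longleftrightarrow> i = col \<beta>" for i \<beta>
    by (auto simp: dual_edge_def)
  have mem_Inr: "Inr {\<beta>, \<gamma>} \<in> ?d \<delta> \<longleftrightarrow> \<delta> = \<beta> \<or> \<delta> = \<gamma>" if "\<beta> \<in> B" "\<gamma> \<in> nb \<beta>" "\<delta> \<in> B" for \<beta> \<gamma> \<delta>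
    using that sym by (auto simp: dual_edge_def doubleton_eq_iff)
  have elim: "x = Inl (col \<beta>) \<or> (\<exists>\<gamma>\<in>nb \<beta>. x = Inr {\<beta>, \<gamma>})" if "x \<in> ?d \<beta>" for x \<beta>
    using that by (auto simp: dual_edge_def)
  have irrefl: "\<gamma> \<noteq> \<beta>" if "\<beta> \<in> B" "\<gamma> \<in> nb \<beta>" for \<beta> \<gamma>
    using proper[OF that] by auto
  have e_cap: "?d \<beta> \<inter> e = {Inl (col \<beta>)}" if "\<beta> \<in> B" for \<beta>
    using col[OF that] by (auto simp: e_def dual_edge_def)
  have carde: "card e = k"
    by (simp add: e_def card_image)
  have cardd: "card (?d \<beta>) = k" if "\<beta> \<in> B" for \<beta>
  proof -
    have "inj_on (\<lambda>\<gamma>. Inr {\<beta>, \<gamma>} :: nat + 'b set) (nb \<beta>)"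
      by (auto simp: inj_on_def doubleton_eq_iff)
    then have "card ((\<lambda>\<gamma>. Inr {\<beta>, \<gamma>} :: nat + 'b set) ` nb \<beta>) = k - 1"
      using nb(2)[OF that] by (simp add: card_image)
    then show ?thesis
      using finnb[OF that] assms(2) by (subst dual_edge_def, subst card_insert_disjoint) auto
  qed
  have ne: "?d \<beta> \<noteq> e" if "\<beta> \<in> B" for \<beta>
  proof
    assume "?d \<beta> = e"
    then have "e = {Inl (col \<beta>)}"
      using e_cap[OF that] by simp
    then show False
      using carde assms(2) by simp
  qed
  have cap: "x = y" if "\<beta> \<in> B" "\<gamma> \<in> B" "\<beta> \<noteq> \<gamma>" "x \<in> ?d \<beta> \<inter> ?d \<gamma>" "y \<in> ?d \<beta> \<inter> ?d \<gamma>" for \<beta> \<gamma> x y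
  proof -
    have x: "(x = Inl (col \<beta>) \<and> col \<gamma> = col \<beta>) \<or> (\<gamma> \<in> nb \<beta> \<and> x = Inr {\<beta>, \<gamma>})"
      if "x \<in> ?d \<beta> \<inter> ?d \<gamma>" for x
    proof -
      from that have "x \<in> ?d \<beta>" "x \<in> ?d \<gamma>"
        by auto
      then show ?thesis
        using elim[OF \<open>x \<in> ?d \<beta>\<close>] mem_Inl mem_Inr[OF \<open>\<beta> \<in> B\<close> _ \<open>\<gamma> \<in> B\<close>] \<open>\<beta> \<noteq> \<gamma>\<close> by metis
    qed
    from x[OF that(4)] x[OF that(5)] show ?thesis
      using proper[OF that(1)] by metis
  qed
  have "finite V"
    unfolding V_def E_def e_def dual_edge_def using assms(1) finnb by auto
  then have unif: "uniform_hypergraph k V E"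
    using carde cardd by (auto simp: uniform_hypergraph_def E_def V_def)
  have "linear_hypergraph E"
    unfolding linear_hypergraph_def
  proof (intro ballI allI impI, rule ccontr)
    fix g h x y
    assume gh: "g \<in> E" "h \<in> E" and xy: "x \<in> g \<inter> h" "y \<in> g \<inter> h" "x \<noteq> y" and "g \<noteq> h"
    show False
    proof (cases "g = e \<or> h = e")
      case True
      then obtain \<beta> where "\<beta> \<in> B" "g \<inter> h = ?d \<beta> \<inter> e"
        using gh \<open>g \<noteq> h\<close> unfolding E_def by auto
      then show False
        using e_cap xy by auto
    next
      case False
      then obtain \<beta> \<gamma> where "\<beta> \<in> B" "\<gamma> \<in> B" "g = ?d \<beta>" "h = ?d \<gamma>"
        using gh unfolding E_def by auto
      then show False
        using cap xy \<open>g \<noteq> h\<close> by blast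
    qed
  qed
  moreover have "\<forall>g\<in>E. g \<inter> e \<noteq> {}"
    using e_cap carde assms(2) by (auto simp: E_def)
  moreover have "\<exists>M. matching E M \<and> card M = k"
  proof (intro exI conjI)
    let ?M = "(\<lambda>i. ?d (r i)) ` {..<k}"
    \<comment> \<open>A common node would be a common colour or a graph edge between
      \<open>r i\<close> and \<open>r j\<close>.\<close>
    have disj: "?d (r i) \<inter> ?d (r j) = {}" if "i < k" "j < k" "i \<noteq> j" for i j
    proof (rule ccontr)
      assume "?d (r i) \<inter> ?d (r j) \<noteq> {}"
      then obtain x where x: "x \<in> ?d (r i)" "x \<in> ?d (r j)"
        by auto
      have "r j \<noteq> r i"
        using rainbow(2) that by metis
      with elim[OF x(1)] x(2) show False
        using mem_Inl mem_Inr rainbow that by metis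
    qed
    then show "matching E ?M"
      using rainbow(1) unfolding matching_def E_def by (auto intro!: disjointI)
    have "inj_on (\<lambda>i. ?d (r i)) {..<k}"
      using mem_Inl rainbow(2) by (intro inj_onI) (metis lessThan_iff)
    then show "card ?M = k"
      by (simp add: card_image)
  qed
  moreover have deg_e: "card (star E v) \<ge> 2" if v: "v \<in> e" for v
  proof -
    obtain i where i: "i < k" "v = Inl i"
      using v by (auto simp: e_def)
    have "finite E"
      using assms(1) by (simp add: E_def)
    have "{e, ?d (r i)} \<subseteq> star E v"
      using i v rainbow mem_Inl by (auto simp: star_def E_def)
    then have "card {e, ?d (r i)} \<le> card (star E v)"
      using \<open>finite E\<close> by (intro card_mono) (auto simp: star_def)
    then show ?thesis
      using ne[OF rainbow(1)[OF i(1)]] by simp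
  qed
  \<comment> \<open>Colour 0 occurs at \<open>r 0\<close> alone. Its node thus provides, inside
    \<open>e\<close>, the degree 2 that all nodes outside \<open>e\<close> have.\<close>
  moreover have deg0: "card (star E (Inl 0)) = 2"
  proof -
    have r0: "r 0 \<in> B" "col (r 0) = 0"
      using rainbow assms(2) by auto
    then have "Inl 0 \<in> ?d \<beta> \<longleftrightarrow> \<beta> = r 0" if "\<beta> \<in> B" for \<beta>
      using that single mem_Inl by metis
    moreover have "Inl 0 \<in> e"
      using assms(2) by (simp add: e_def)
    ultimately have "star E (Inl 0) = {e, ?d (r 0)}"
      unfolding star_def E_def using r0(1) by blast
    then show ?thesis
      using ne[OF rainbow(1)[of 0]] assms(2) by simp
  qed
  moreover have deg_d: "card (star E v) = 2" if v: "v \<in> V" "v \<notin> e" for v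
  proof -
    obtain \<beta> where \<beta>: "\<beta> \<in> B" "v \<in> ?d \<beta>"
      using v by (auto simp: V_def E_def)
    then obtain \<gamma> where \<gamma>: "\<gamma> \<in> nb \<beta>" "v = Inr {\<beta>, \<gamma>}"
      using elim[OF \<beta>(2)] e_cap v(2) by blast
    have \<gamma>B: "\<gamma> \<in> B"
      using nb(1) \<beta>(1) \<gamma>(1) by auto
    have "star E v = {?d \<beta>, ?d \<gamma>}"
      using mem_Inr[OF \<beta>(1) \<gamma>(1)] \<gamma>(2) v(2) \<beta>(1) \<gamma>B by (auto simp: star_def E_def)
    moreover have "?d \<beta> \<noteq> ?d \<gamma>"
      using mem_Inl proper[OF \<beta>(1) \<gamma>(1)] by metis
    ultimately show ?thesis
      by simp
  qed
  moreover have "Inl 0 \<in> e"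
    using assms(2) by (simp add: e_def)
  ultimately have "trap k V E e"
    using unif unfolding trap_def E_def by (metis insertI1 order_refl)
  moreover have "V \<noteq> {}"
    using \<open>Inl 0 \<in> e\<close> by (auto simp: V_def E_def)
  ultimately show ?thesis
    by blast
qed

section \<open>The coloured graph and the resulting trap\<close>

text \<open>
  \<open>Inl i\<close> is a vertex of \<open>K\<^sub>k\<close>; \<open>Inr (s, t, b)\<close> is the vertex number \<open>t\<close> on the side \<open>b\<close> of the
  copy of \<open>K\<^bsub>k-1,k-1\<^esub>\<close> that supplies the colour \<open>s\<close> of the independent set.
\<close>

fun trap_nb :: "nat \<Rightarrow> nat + nat \<times> nat \<times> bool \<Rightarrow> (nat + nat \<times> nat \<times> bool) set" where
  "trap_nb k (Inl i) = Inl ` ({..<k} - {i})"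
| "trap_nb k (Inr (s, t, b)) = (\<lambda>t'. Inr (s, t', \<not> b)) ` {..<k - 1}"

fun trap_col :: "nat + nat \<times> nat \<times> bool \<Rightarrow> nat" where
  "trap_col (Inl i) = i"
| "trap_col (Inr (s, t, b)) = (if b then s else if s = 1 then 2 else 1)"

text \<open>\<open>r\<close> takes one vertex from each component, so its values are independent.
  Colour 0 occurs only at \<open>Inl 0\<close>, since the bipartite copies use colours from 1 on.
  Copy 1 has colour 2 on its other side, which is a colour because \<open>k \<ge> 3\<close>.\<close>

lemma trap_exists:
  assumes "infinite (UNIV :: 'a set)" "k \<ge> 3"
  shows "\<exists>V E e. trap k (V :: 'a set) E e \<and> V \<noteq> {}"
proof -
  define B :: "(nat + nat \<times> nat \<times> bool) set"
    where "B = Inl ` {..<k} \<union> Inr ` ({1..<k} \<times> {..<k - 1} \<times> UNIV)"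
  define r :: "nat \<Rightarrow> nat + nat \<times> nat \<times> bool"
    where "r i = (if i = 0 then Inl 0 else Inr (i, 0, True))" for i
  have "\<exists>V E e. trap k (V :: (nat + (nat + nat \<times> nat \<times> bool) set) set) E e \<and> V \<noteq> {}"
  proof (rule trap_dual[where B = B and nb = "trap_nb k" and col = trap_col and r = r])
    show "card (trap_nb k \<beta>) = k - 1" if "\<beta> \<in> B" for \<beta>
      using that by (auto simp: B_def card_image inj_on_def)
    show "trap_nb k \<beta> \<subseteq> B" if "\<beta> \<in> B" for \<beta>
      using that by (auto simp: B_def)
    show "\<beta> \<in> trap_nb k \<gamma>" if "\<beta> \<in> B" "\<gamma> \<in> trap_nb k \<beta>" for \<beta> \<gamma>
      using that by (auto simp: B_def image_iff)
    show "trap_col \<beta> \<noteq> trap_col \<gamma>" if "\<beta> \<in> B" "\<gamma> \<in> trap_nb k \<beta>" for \<beta> \<gamma>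
      using that by (cases \<beta> rule: trap_col.cases; cases \<gamma> rule: trap_col.cases)
        (auto simp: B_def split: if_splits)
    show "\<beta> = r 0" if "\<beta> \<in> B" "trap_col \<beta> = 0" for \<beta>
      using that by (auto simp: B_def r_def split: if_splits)
    show "r i \<notin> trap_nb k (r j)" if "i < k" "j < k" for i j
      using that by (auto simp: r_def)
  qed (use assms(2) in \<open>auto simp: B_def r_def split: if_splits\<close>)
  then obtain V :: "(nat + (nat + nat \<times> nat \<times> bool) set) set" and E e where t: "trap k V E e" "V \<noteq> {}"
    by blast
  \<comment> \<open>An infinite type contains a set of the size of \<open>V\<close>, and a bijection
    carries the trap there.\<close>
  have "finite V"
    using t(1) by (simp add: trap_def uniform_hypergraph_def)
  moreover obtain W :: "'a set" where "finite W" "card W = card V"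
    using infinite_arbitrarily_large[OF assms(1)] by metis
  ultimately obtain f where "bij_betw f V W"
    using finite_same_card_bij by metis
  then have "trap k (f ` V) ((`) f ` E) (f ` e)"
    using t(1) by (intro trap_image) (auto simp: bij_betw_def)
  then show ?thesis
    using t(2) by blast
qed

section \<open>The bound on the approximation ratio\<close>

theorem theorem9:
  fixes k :: nat and A :: "'a algorithm"
  assumes "infinite (UNIV :: 'a set)"
    and "k \<ge> 3"
    and "greedy_adaptive_priority_algorithm k A"
  shows "(\<exists>V E. uniform_hypergraph k V E \<and> matching_number E > 0 \<and>
            real (card (computed_matching A V E)) \<le> 1 / real k * real (matching_number E)) \<and>
         (\<forall>\<rho>. achieves_ratio k A \<rho> \<longrightarrow> \<rho> \<le> 1 / real k)"
proof -
  obtain V0 E0 and e0 :: "'a set" where "trap k V0 E0 e0" "V0 \<noteq> {}"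
    using trap_exists[OF assms(1,2)] by blast
  then obtain E e where t: "trap k V0 E e" and cm: "computed_matching A V0 E = {e}"
    using trap_relabelling[OF _ _ assms(3)] by metis
  from t have unif: "uniform_hypergraph k V0 E"
    by (simp add: trap_def)
  have nu: "k \<le> matching_number E"
    using t matching_number_ge[OF unif] by (auto simp: trap_def)
  \<comment> \<open>Positivity excludes the degenerate instance without hyperedges and later allows
    cancelling the matching number.\<close>
  have pos: "matching_number E > 0"
    using nu assms(2) by linarith
  have le: "real (card (computed_matching A V0 E)) \<le> 1 / real k * real (matching_number E)"
    using nu assms(2) cm by (simp add: field_simps)
  have "\<rho> \<le> 1 / real k" if "achieves_ratio k A \<rho>" for \<rho>
  proof -
    have "\<rho> * real (matching_number E) \<le> 1 / real k * real (matching_number E)"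
      using that unif le unfolding achieves_ratio_def by (meson order_trans)
    then show ?thesis
      using pos by (simp only: mult_le_cancel_right_pos of_nat_0_less_iff)
  qed
  with unif pos le show ?thesis
    by blast
qed

end
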